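(* Let $(\mathcal{H},\Sigma_{\mathcal{H}})$ be a measurable space, $P_g$ a probability measure on it, and $(P_\alpha)_{\alpha\in\mathcal{A}}$ a non-empty family of probability measures on it. For every $\alpha\in\mathcal{A}$ and every pair of sub-$\sigma$-algebras $\mathcal{G}\subseteq\mathcal{G}'\subseteq\Sigma_{\mathcal{H}}$, $$\mathrm{TV}\big(P_g|_{\mathcal{G}},P_\alpha|_{\mathcal{G}}\big)\;\le\;\mathrm{TV}\big(P_g|_{\mathcal{G}'},P_\alpha|_{\mathcal{G}'}\big),\qquad(\ast)$$ and consequently $\delta_{\mathcal{G}}\le\delta_{\mathcal{G}'}$, where $\delta_{\mathcal{G}}=\inf_{\alpha\in\mathcal{A}}\mathrm{TV}(P_g|_{\mathcal{G}},P_\alpha|_{\mathcal{G}})$ and likewise for $\mathcal{G}'$. Moreover, fix $\alpha\in\mathcal{A}$ and put $\lambda=P_g+P_\alpha$, $p=\mathrm{d}P_g/\mathrm{d}\lambda$, $q=\mathrm{d}P_\alpha/\mathrm{d}\lambda$. Equality holds in $(\ast)$ at $\alpha$ if and only if $$\big|\mathbb{E}_\lambda[p-q\mid\mathcal{G}]\big|=\mathbb{E}_\lambda\Big[\big|\mathbb{E}_\lambda[p-q\mid\mathcal{G}']\big|\;\Big|\;\mathcal{G}\Big]\qquad\lambda\text{-a.e.},$$ that is, if and only if $\mathbb{E}_\lambda[p-q\mid\mathcal{G}']$ has an almost surely constant sign conditionally on $\mathcal{G}$. The inequality $(\ast)$ at $\alpha$ is therefore strict exactly when $$\lambda\Big(\Pr\nolimits_\lambda\big(\mathbb{E}_\lambda[p-q\mid\mathcal{G}']>0\mid\mathcal{G}\big)>0\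 \text{ and }\ \Pr\nolimits_\lambda\big(\mathbb{E}_\lambda[p-q\mid\mathcal{G}']<0\mid\mathcal{G}\big)>0\Big)>0.$$ Separately, every $\mathcal{G}$-measurable rule is $\mathcal{G}'$-measurable, so for each $\alpha\in\mathcal{A}$ the set of pairs $(\mathrm{FUR}(d;\alpha),\mathrm{RRL}(d))$ achievable by $\mathcal{G}$-measurable rules $d$ is a subset of the set achievable by $\mathcal{G}'$-measurable rules, and no rule on the coarser $\sigma$-algebra $\mathcal{G}$ can outperform the best rule on the finer one $\mathcal{G}'$.
   Context: Interpretation: $\mathcal{H}$ is a space of interaction histories; $P_g$ is the law of the history when a candidate claim is genuine (it does not depend on $\alpha$), and $P_\alpha$ is its law when the claim is adversarial and the adversary uses policy $\alpha$ in the non-empty feasible set $\mathcal{A}$. $P|_{\mathcal{G}}$ is the restriction of $P$ to $\mathcal{G}$, and $\mathrm{TV}(P,Q)=\sup_{A\in\mathcal{G}}|P(A)-Q(A)|$ for probability measures on $\mathcal{G}$. $\mathbb{E}_\lambda[\cdot\mid\mathcal{G}]$ is conditional expectation with respect to the finite measure $\lambda$ (of total mass $2$), i.e. the $\mathcal{G}$-measurable function with the same $\lambda$-integrals over sets of $\mathcal{G}$; it coincides with conditional expectation under the probability measure $\lambda/2$. $\Pr_\lambda(A\mid\mathcal{G})=\mathbb{E}_\lambda[\mathbf{1}_A\mid\mathcal{G}]$. "$X$ has almost surely constant sign conditionally on $\mathcal{G}$" is meant in the weak sense: for $\lambda$-almost every point, the conditional probabilities $\Pr_\lambda(X>0\mid\mathcal{G})$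 and $\Pr_\lambda(X<0\mid\mathcal{G})$ are not both positive. A $\mathcal{G}$-measurable rule is a $\mathcal{G}$-measurable map $d:\mathcal{H}\to[0,1]$ ($d(H)$ is the probability of accepting the claim), with error rates $$\mathrm{FUR}(d;\alpha)=\int d\,\mathrm{d}P_\alpha,\qquad \mathrm{RRL}(d)=1-\int d\,\mathrm{d}P_g.$$ *)

theory Defs
  imports "HOL-Probability.Probability"
begin

definition add_measure :: "'h measure \<Rightarrow> 'h measure \<Rightarrow> 'h measure" where
  "add_measure M N = measure_of (space M) (sets M) (\<lambda>A. emeasure M A + emeasure N A)"

lemma space_add_measure [simp]: "space (add_measure M N) = space M"
  and sets_add_measure [simp, measurable_cong]: "sets (add_measure M N) = sets M"
  by (auto simp: add_measure_def)

lemma emeasure_add_measure: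
  assumes "sets N = sets M" "A \<in> sets M"
  shows "emeasure (add_measure M N) A = emeasure M A + emeasure N A"
  unfolding add_measure_def
proof (rule emeasure_measure_of_sigma)
  show "sigma_algebra (space M) (sets M)" ..
  show "positive (sets M) (\<lambda>A. emeasure M A + emeasure N A)"
    by (simp add: positive_def)
  show "countably_additive (sets M) (\<lambda>A. emeasure M A + emeasure N A)"
  proof (rule countably_additiveI)
    fix B :: "nat \<Rightarrow> 'a set"
    assume B: "range B \<subseteq> sets M" "disjoint_family B" "(\<Union>i. B i) \<in> sets M"
    then have "(\<Sum>i. emeasure M (B i)) = emeasure M (\<Union>i. B i)"
      "(\<Sum>i. emeasure N (B i)) = emeasure N (\<Union>i. B i)"
      using assms(1) by (auto intro!: suminf_emeasure)
    then show "(\<Sum>i. emeasure M (B i) + emeasure N (B i)) = emeasure M (\<Union>i. B i) + emeasure N (\<Union>i. B i)"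
      by (subst suminf_add[symmetric]) auto
  qed
qed fact

text \<open>A sub-sigma-algebra of \<open>M\<close> is represented, as in the library, by a measure \<open>G\<close> with
  \<open>subalgebra M G\<close>; only the space and the measurable sets of \<open>G\<close> matter. The restriction of a
  measure to it is \<open>restr_to_subalg\<close>.\<close>

definition TV :: "'h measure \<Rightarrow> 'h measure \<Rightarrow> real" where
  "TV P Q = (SUP A\<in>sets P. \<bar>measure P A - measure Q A\<bar>)"

abbreviation TV_on :: "'h measure \<Rightarrow> 'h measure \<Rightarrow> 'h measure \<Rightarrow> real" where
  "TV_on G P Q \<equiv> TV (restr_to_subalg P G) (restr_to_subalg Q G)"

definition TV_inf :: "'h measure \<Rightarrow> 'h measure \<Rightarrow> ('a \<Rightarrow> 'h measure) \<Rightarrow> 'a set \<Rightarrow> real" where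
  "TV_inf G Pg P \<A> = (INF \<alpha>\<in>\<A>. TV_on G Pg (P \<alpha>))"

text \<open>Real-valued version of the library's Radon-Nikodym derivative (which is \<open>ennreal\<close>-valued, and
  finite almost everywhere in the case of finite measures).\<close>

definition real_RN_deriv :: "'h measure \<Rightarrow> 'h measure \<Rightarrow> 'h \<Rightarrow> real" where
  "real_RN_deriv M N x = enn2real (RN_deriv M N x)"

definition cond_Pr :: "'h measure \<Rightarrow> 'h measure \<Rightarrow> 'h set \<Rightarrow> 'h \<Rightarrow> real" where
  "cond_Pr M G A = real_cond_exp M G (indicator A)"

text \<open>Both signs have positive conditional probability at the point \<open>x\<close>.\<close>

definition both_signs :: "'h measure \<Rightarrow> 'h measure \<Rightarrow> ('h \<Rightarrow> real) \<Rightarrow> 'h \<Rightarrow> bool" where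
  "both_signs M G X x \<longleftrightarrow>
     cond_Pr M G {y \<in> space M. X y > 0} x > 0 \<and> cond_Pr M G {y \<in> space M. X y < 0} x > 0"

definition cond_constant_sign :: "'h measure \<Rightarrow> 'h measure \<Rightarrow> ('h \<Rightarrow> real) \<Rightarrow> bool" where
  "cond_constant_sign M G X \<longleftrightarrow> (AE x in M. \<not> both_signs M G X x)"

text \<open>Randomised decision rules; \<open>d x\<close> is the probability of acceptance. \<open>FUR\<close> takes the law under
  an adversarial claim, \<open>RRL\<close> the law under a genuine one.\<close>

definition rules :: "'h measure \<Rightarrow> ('h \<Rightarrow> real) set" where
  "rules G = {d \<in> borel_measurable G. \<forall>x\<in>space G. 0 \<le> d x \<and> d x \<le> 1}"

definition FUR :: "'h measure \<Rightarrow> ('h \<Rightarrow> real) \<Rightarrow> real" where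
  "FUR P d = (\<integral>x. d x \<partial>P)"

definition RRL :: "'h measure \<Rightarrow> ('h \<Rightarrow> real) \<Rightarrow> real" where
  "RRL Pg d = 1 - (\<integral>x. d x \<partial>Pg)"

definition achievable :: "'h measure \<Rightarrow> 'h measure \<Rightarrow> 'h measure \<Rightarrow> (real \<times> real) set" where
  "achievable G Pg P = (\<lambda>d. (FUR P d, RRL Pg d)) ` rules G"

end

theory Submission
  imports Defs
begin

text \<open>Write \<open>f = p - q\<close>. On a sub-sigma-algebra \<open>F\<close> the signed measure \<open>P\<^sub>g - P\<^sub>\<alpha>\<close> has density
  \<open>E[f | F]\<close>, which has integral 0, so the supremum defining the total variation is attained at
  \<open>{E[f | F] > 0}\<close> and equals half of the \<open>L\<^sup>1\<close>-norm of \<open>E[f | F]\<close>. By the tower property and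
  conditional Jensen, \<open>\<bar>E[f | G]\<bar> \<le> E[\<bar>E[f | G']\<bar> | G]\<close>; integrating gives the inequality, with
  equality iff the two sides agree a.e. Finally \<open>\<bar>E[X | G]\<bar> = E[\<bar>X\<bar> | G]\<close> says that
  \<open>E[X\<^sup>+ | G]\<close> and \<open>E[X\<^sup>- | G]\<close> are not both positive, and these have the same positivity sets as
  the conditional probabilities of \<open>X > 0\<close> and \<open>X < 0\<close>.\<close>

section \<open>The sum of two measures and densities with respect to it\<close>

lemma finite_measure_add_measure:
  assumes "finite_measure M" "finite_measure N" "sets N = sets M"
  shows "finite_measure (add_measure M N)"
proof
  interpret M: finite_measure M by fact
  interpret N: finite_measure N by fact
  show "emeasure (add_measure M N) (space (add_measure M N)) \<noteq> \<infinity>"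
    using assms(3) by (simp add: emeasure_add_measure M.emeasure_eq_measure N.emeasure_eq_measure)
qed

lemma absolutely_continuous_add_measure:
  assumes "sets N = sets M"
  shows "absolutely_continuous (add_measure M N) M" "absolutely_continuous (add_measure M N) N"
  using assms by (auto simp: absolutely_continuous_def null_sets_def emeasure_add_measure)

text \<open>The library's change-of-density rules are already phrased with \<open>enn2real\<close>;
  the constant 1 gives integrability, and indicators give the measures of sets.\<close>

lemma (in finite_measure) real_RN_deriv_measure:
  assumes "finite_measure N" "absolutely_continuous M N" "sets N = sets M"
  shows "integrable M (real_RN_deriv M N)"
    and "A \<in> sets M \<Longrightarrow> measure N A = (\<integral>x. indicator A x * real_RN_deriv M N x \<partial>M)"
proof -
  interpret N: finite_measure N by fact
  note RN = RN_deriv_integrable[OF N.sigma_finite_measure_axioms assms(2,3)]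
    RN_deriv_integral[OF N.sigma_finite_measure_axioms assms(2,3)]
  show "integrable M (real_RN_deriv M N)"
    using RN(1)[of "\<lambda>_. 1"] by (simp add: real_RN_deriv_def[abs_def])
  show "measure N A = (\<integral>x. indicator A x * real_RN_deriv M N x \<partial>M)" if A: "A \<in> sets M"
  proof -
    have "measure N A = (\<integral>x. indicator A x \<partial>N)"
      using sets_eq_imp_space_eq[OF assms(3)] sets.sets_into_space[OF A]
      by (simp add: Int_absorb2)
    also have "\<dots> = (\<integral>x. real_RN_deriv M N x * indicator A x \<partial>M)"
      using RN(2)[of "indicator A"] A by (simp add: real_RN_deriv_def)
    finally show ?thesis by (simp add: mult.commute)
  qed
qed

section \<open>Total variation as half an L1 norm\<close>

context finite_measure_subalgebra
begin

lemma TV_on_eq_integral_cond_exp: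
  assumes f: "integrable M f" "(\<integral>x. f x \<partial>M) = 0"
    and subalgs: "subalgebra P F" "subalgebra Q F"
    and diff: "\<And>A. A \<in> sets F \<Longrightarrow> measure P A - measure Q A = (\<integral>x. indicator A x * f x \<partial>M)"
  shows "TV_on F P Q = (\<integral>x. \<bar>real_cond_exp M F f x\<bar> \<partial>M) / 2"
proof -
  define D where "D = real_cond_exp M F f"
  have [measurable]: "D \<in> borel_measurable F"
    by (simp add: D_def)
  have D: "integrable M D" "(\<integral>x. D x \<partial>M) = 0"
    using real_cond_exp_int[OF f(1)] f(2) by (simp_all add: D_def)
  have indD: "integrable M (\<lambda>x. indicator A x * D x)" if "A \<in> sets F" for A
    using integrable_mult_indicator[OF _ D(1), of A] that subalg by (auto simp: subalgebra_def)
  \<comment> \<open>Since \<open>D\<close> has integral 0, the indicator may be shifted by 1/2. The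
    shifted weight has absolute value 1/2 everywhere, which gives the sharp factor in the bound
    below.\<close>
  have diff': "measure P A - measure Q A = (\<integral>x. (indicator A x - 1/2) * D x \<partial>M)"
    if A: "A \<in> sets F" for A
  proof -
    have "integrable M (\<lambda>x. indicator A x * f x)"
      using integrable_mult_indicator[OF _ f(1), of A] A subalg by (auto simp: subalgebra_def)
    then have "measure P A - measure Q A = (\<integral>x. indicator A x * D x \<partial>M)"
      unfolding D_def using A f(1) by (simp add: diff real_cond_exp_intg)
    also have "\<dots> = (\<integral>x. indicator A x * D x - 1/2 * D x \<partial>M)"
      using D indD[OF A] by simp
    finally show ?thesis
      by (simp add: left_diff_distrib)
  qed
  have bound: "\<bar>measure P A - measure Q A\<bar> \<le> (\<integral>x. \<bar>D x\<bar> \<partial>M) / 2" if A: "A \<in> sets F" for A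
  proof -
    have int: "integrable M (\<lambda>x. (indicator A x - 1/2) * D x)"
      using D indD[OF A] by (simp add: left_diff_distrib)
    have "\<bar>measure P A - measure Q A\<bar> \<le> (\<integral>x. \<bar>(indicator A x - 1/2) * D x\<bar> \<partial>M)"
      unfolding diff'[OF A] by (rule integral_abs_bound)
    also have "\<dots> = (\<integral>x. \<bar>D x\<bar> / 2 \<partial>M)"
      by (intro Bochner_Integration.integral_cong) (auto simp: abs_mult indicator_def)
    finally show ?thesis by simp
  qed
  define B where "B = {x \<in> space F. D x > 0}"
  have B: "B \<in> sets F" by (simp add: B_def)
  \<comment> \<open>On \<open>B\<close> the weight is 1/2 and \<open>D\<close> is positive; off
    \<open>B\<close> the weight is -1/2 and \<open>D\<close> is at most 0. In both cases the
    integrand equals half of the absolute value of \<open>D\<close>.\<close>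
  have "measure P B - measure Q B = (\<integral>x. \<bar>D x\<bar> / 2 \<partial>M)"
    unfolding diff'[OF B] using subalg
    by (intro Bochner_Integration.integral_cong) (auto simp: B_def indicator_def subalgebra_def)
  moreover have "0 \<le> (\<integral>x. \<bar>D x\<bar> \<partial>M)"
    by simp
  ultimately have attained: "\<bar>measure P B - measure Q B\<bar> = (\<integral>x. \<bar>D x\<bar> \<partial>M) / 2"
    by (simp only: integral_divide_zero)
  have restr: "measure (restr_to_subalg P F) A = measure P A"
    "measure (restr_to_subalg Q F) A = measure Q A" if "A \<in> sets F" for A
    using that subalgs by (simp_all add: measure_def emeasure_restr_to_subalg)
  have "TV_on F P Q = (SUP A\<in>sets F. \<bar>measure P A - measure Q A\<bar>)"
    unfolding TV_def by (simp add: sets_restr_to_subalg[OF subalgs(1)] restr cong: SUP_cong)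
  also have "\<dots> = (\<integral>x. \<bar>D x\<bar> \<partial>M) / 2"
  proof (rule cSup_eq_maximum)
    show "(\<integral>x. \<bar>D x\<bar> \<partial>M) / 2 \<in> (\<lambda>A. \<bar>measure P A - measure Q A\<bar>) ` sets F"
      unfolding attained[symmetric] using B by (rule imageI)
  qed (use bound in auto)
  finally show ?thesis by (simp add: D_def)
qed

section \<open>Positivity sets of conditional expectations and conditional signs\<close>

lemma real_cond_exp_eq_0_transfer:
  assumes Y: "integrable M Y" "\<And>x. x \<in> space M \<Longrightarrow> 0 \<le> Y x"
    and Z: "integrable M Z"
    and YZ: "\<And>x. x \<in> space M \<Longrightarrow> Y x = 0 \<Longrightarrow> Z x = 0"
  shows "AE x in M. real_cond_exp M F Y x = 0 \<longrightarrow> real_cond_exp M F Z x = 0"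
proof -
  \<comment> \<open>On this zero set the nonnegative \<open>Y\<close> has integral 0, because
    \<open>B\<close> lies in \<open>F\<close>. Hence \<open>Y\<close> vanishes a.e. on
    \<open>B\<close>, and therefore so does \<open>Z\<close>.\<close>
  define B where "B = {x \<in> space F. real_cond_exp M F Y x = 0}"
  have BF: "B \<in> sets F" by (simp add: B_def)
  have BM: "B \<in> sets M" and sp: "space F = space M"
    using BF subalg by (auto simp: subalgebra_def)
  have [measurable]: "Y \<in> borel_measurable M" "Z \<in> borel_measurable M" "B \<in> sets F" "B \<in> sets M"
    using Y Z BF BM by auto
  have intg: "integrable M (\<lambda>x. indicator B x * Y x)" "integrable M (\<lambda>x. indicator B x * Z x)"
    using integrable_mult_indicator[OF BM Y(1)] integrable_mult_indicator[OF BM Z] by auto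
  have "(\<integral>x. indicator B x * Y x \<partial>M) = (\<integral>x. indicator B x * real_cond_exp M F Y x \<partial>M)"
    using intg(1) by (intro real_cond_exp_intg(2)[symmetric]) auto
  also have "\<dots> = (\<integral>x. 0 \<partial>M)"
    by (intro Bochner_Integration.integral_cong) (auto simp: B_def indicator_def)
  finally have "AE x in M. indicator B x * Y x = 0"
    using Y(2) integral_nonneg_eq_0_iff_AE[OF intg(1)] by simp
  then have "AE x in M. indicator B x * Z x = 0"
    using AE_space by eventually_elim (use YZ in auto)
  \<comment> \<open>The factor \<open>indicator B\<close> is measurable in \<open>F\<close> and can
    be pulled out of the conditional expectation, which localises the conclusion to
    \<open>B\<close>.\<close>
  then have "AE x in M. real_cond_exp M F (\<lambda>x. indicator B x * Z x) x = real_cond_exp M F (\<lambda>_. 0) x"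
    by (intro real_cond_exp_cong) auto
  moreover have "AE x in M. real_cond_exp M F (\<lambda>_. 0) x = 0"
    by (rule real_cond_exp_F_meas) auto
  moreover have "AE x in M. real_cond_exp M F (\<lambda>x. indicator B x * Z x) x
      = indicator B x * real_cond_exp M F Z x"
    using intg(2) by (intro real_cond_exp_mult) auto
  ultimately show ?thesis
    using AE_space by eventually_elim (auto simp: B_def sp indicator_def)
qed

text \<open>A nonnegative \<open>Y\<close> and the indicator of \<open>Y > 0\<close> have the same
  zeros, so the transfer of zero sets applies in both directions; both conditional expectations are
  a.e. nonnegative, so nonzero means positive.\<close>

lemma cond_Pr_pos_iff:
  assumes Y: "integrable M Y" "\<And>x. x \<in> space M \<Longrightarrow> 0 \<le> Y x"
  shows "AE x in M. cond_Pr M F {x \<in> space M. Y x > 0} x > 0 \<longleftrightarrow> real_cond_exp M F Y x > 0"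
proof -
  define I where "I = (indicator {x \<in> space M. Y x > 0} :: 'a \<Rightarrow> real)"
  have [measurable]: "Y \<in> borel_measurable M" using Y by auto
  have I: "integrable M I"
    unfolding I_def by (intro integrable_real_indicator) (simp_all add: less_top[symmetric])
  have "AE x in M. real_cond_exp M F Y x = 0 \<longrightarrow> real_cond_exp M F I x = 0"
    by (rule real_cond_exp_eq_0_transfer[OF Y(1) _ I]) (simp_all add: I_def Y(2))
  moreover have "AE x in M. real_cond_exp M F I x = 0 \<longrightarrow> real_cond_exp M F Y x = 0"
  proof (rule real_cond_exp_eq_0_transfer[OF I _ Y(1)])
    show "Y x = 0" if "x \<in> space M" "I x = 0" for x
      using that Y(2)[of x] by (auto simp: I_def indicator_def split: if_splits)
  qed (simp add: I_def)
  moreover have "AE x in M. real_cond_exp M F Y x \<ge> 0"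
    using Y(2) by (intro real_cond_exp_pos AE_I2) simp_all
  moreover have "AE x in M. real_cond_exp M F I x \<ge> 0"
    using I by (intro real_cond_exp_pos AE_I2) (simp_all add: I_def)
  ultimately show ?thesis
    unfolding cond_Pr_def I_def[symmetric] by eventually_elim auto
qed

text \<open>Let u and v be the conditional expectations of the positive and negative parts of
  \<open>X\<close>. The equation reads |u - v| = u + v, which for nonnegative u and v holds exactly
  when they are not both positive.\<close>

lemma abs_real_cond_exp_eq_iff_cond_constant_sign:
  assumes X: "integrable M X"
  shows "(AE x in M. \<bar>real_cond_exp M F X x\<bar> = real_cond_exp M F (\<lambda>x. \<bar>X x\<bar>) x)
    \<longleftrightarrow> cond_constant_sign M F X"
proof -
  let ?u = "real_cond_exp M F (\<lambda>x. max 0 (X x))" and ?v = "real_cond_exp M F (\<lambda>x. max 0 (- X x))"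
  have int: "integrable M (\<lambda>x. max 0 (X x))" "integrable M (\<lambda>x. max 0 (- X x))"
    using X by auto
  have parts: "X = (\<lambda>x. max 0 (X x) - max 0 (- X x))"
    "(\<lambda>x. \<bar>X x\<bar>) = (\<lambda>x. max 0 (X x) + max 0 (- X x))"
    by (auto simp: fun_eq_iff)
  have diff: "AE x in M. real_cond_exp M F X x = ?u x - ?v x"
    using real_cond_exp_diff[OF int] unfolding parts(1)[symmetric] .
  have add: "AE x in M. real_cond_exp M F (\<lambda>x. \<bar>X x\<bar>) x = ?u x + ?v x"
    using real_cond_exp_add[OF int] unfolding parts(2)[symmetric] .
  have nonneg: "AE x in M. 0 \<le> ?u x" "AE x in M. 0 \<le> ?v x"
    using int by (intro real_cond_exp_pos AE_I2; simp)+
  have pos: "AE x in M. cond_Pr M F {x \<in> space M. X x > 0} x > 0 \<longleftrightarrow> ?u x > 0"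
    "AE x in M. cond_Pr M F {x \<in> space M. X x < 0} x > 0 \<longleftrightarrow> ?v x > 0"
    using cond_Pr_pos_iff[OF int(1), OF max.cobounded1] cond_Pr_pos_iff[OF int(2), OF max.cobounded1]
    by (simp_all add: less_max_iff_disj)
  have "AE x in M. \<bar>real_cond_exp M F X x\<bar> = real_cond_exp M F (\<lambda>x. \<bar>X x\<bar>) x
      \<longleftrightarrow> \<not> both_signs M F X x"
    using diff add nonneg pos unfolding both_signs_def by eventually_elim auto
  then show ?thesis
    unfolding cond_constant_sign_def by (rule eventually_subst)
qed

section \<open>L1 contraction and its equality case\<close>

lemma abs_real_cond_exp_le:
  assumes X: "integrable M X"
  shows "AE x in M. \<bar>real_cond_exp M F X x\<bar> \<le> real_cond_exp M F (\<lambda>x. \<bar>X x\<bar>) x"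
proof (rule real_cond_exp_jensens_inequality(2)[OF X])
  \<comment> \<open>The absolute value is the distance from 0, and distances are convex.\<close>
  show "convex_on UNIV (abs :: real \<Rightarrow> real)"
    using convex_on_dist[OF convex_UNIV, of "0::real"] by (simp add: dist_real_def)
qed (use X in simp_all)

text \<open>The Jensen gap \<open>?g\<close> is a.e. nonnegative. As conditional expectation
  preserves integrals, its integral is the difference of the two L1 norms, and this is 0 only if the
  gap vanishes a.e.\<close>

lemma integral_abs_real_cond_exp:
  assumes X: "integrable M X"
  shows integral_abs_real_cond_exp_le: "(\<integral>x. \<bar>real_cond_exp M F X x\<bar> \<partial>M) \<le> (\<integral>x. \<bar>X x\<bar> \<partial>M)"
    and integral_abs_real_cond_exp_eq_iff:
      "(\<integral>x. \<bar>real_cond_exp M F X x\<bar> \<partial>M) = (\<integral>x. \<bar>X x\<bar> \<partial>M) \<longleftrightarrow>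
        (AE x in M. \<bar>real_cond_exp M F X x\<bar> = real_cond_exp M F (\<lambda>x. \<bar>X x\<bar>) x)"
proof -
  let ?g = "\<lambda>x. real_cond_exp M F (\<lambda>x. \<bar>X x\<bar>) x - \<bar>real_cond_exp M F X x\<bar>"
  have absX: "integrable M (\<lambda>x. \<bar>X x\<bar>)" using X by simp
  have g: "integrable M ?g" "AE x in M. 0 \<le> ?g x"
    using real_cond_exp_int(1)[OF X] real_cond_exp_int(1)[OF absX] abs_real_cond_exp_le[OF X] by auto
  have int_g: "(\<integral>x. ?g x \<partial>M) = (\<integral>x. \<bar>X x\<bar> \<partial>M) - (\<integral>x. \<bar>real_cond_exp M F X x\<bar> \<partial>M)"
    using real_cond_exp_int(1)[OF X] real_cond_exp_int[OF absX] by simp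
  show "(\<integral>x. \<bar>real_cond_exp M F X x\<bar> \<partial>M) \<le> (\<integral>x. \<bar>X x\<bar> \<partial>M)"
    using integral_nonneg_AE[OF g(2)] int_g by simp
  have "(\<integral>x. \<bar>real_cond_exp M F X x\<bar> \<partial>M) = (\<integral>x. \<bar>X x\<bar> \<partial>M) \<longleftrightarrow> (\<integral>x. ?g x \<partial>M) = 0"
    unfolding int_g by linarith
  also have "\<dots> \<longleftrightarrow> (AE x in M. ?g x = 0)"
    by (rule integral_nonneg_eq_0_iff_AE[OF g])
  also have "\<dots> \<longleftrightarrow> (AE x in M. \<bar>real_cond_exp M F X x\<bar> = real_cond_exp M F (\<lambda>x. \<bar>X x\<bar>) x)"
    by (simp only: right_minus_eq eq_commute[of "real_cond_exp M F (\<lambda>x. \<bar>X x\<bar>) _"])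
  finally show "(\<integral>x. \<bar>real_cond_exp M F X x\<bar> \<partial>M) = (\<integral>x. \<bar>X x\<bar> \<partial>M) \<longleftrightarrow>
        (AE x in M. \<bar>real_cond_exp M F X x\<bar> = real_cond_exp M F (\<lambda>x. \<bar>X x\<bar>) x)" .
qed

end

lemma borel_measurable_cond_Pr [measurable]: "cond_Pr M F A \<in> borel_measurable M"
  unfolding cond_Pr_def by simp

lemma not_cond_constant_sign_iff:
  "\<not> cond_constant_sign M F X \<longleftrightarrow> emeasure M {x \<in> space M. both_signs M F X x} > 0"
proof -
  have [measurable]: "Measurable.pred M (both_signs M F X)"
    unfolding both_signs_def[abs_def] by measurable
  \<comment> \<open>The double negation is the exceptional set of the a.e. statement that
    \<open>both_signs\<close> fails.\<close>
  have "cond_constant_sign M F X \<longleftrightarrow> emeasure M {x \<in> space M. \<not> \<not> both_signs M F X x} = 0"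
    unfolding cond_constant_sign_def by (rule AE_iff_measurable) auto
  then show ?thesis by (simp add: zero_less_iff_neq_zero)
qed

section \<open>One genuine and one adversarial law on nested sigma-algebras\<close>

locale dominated_pair =
  fixes Pg Q G G' :: "'h measure"
  assumes prob: "prob_space Pg" "prob_space Q"
    and sets_eq: "sets Q = sets Pg"
    and sub: "subalgebra Pg G'" "subalgebra G' G"
begin

definition "L = add_measure Pg Q"
definition "f = (\<lambda>x. real_RN_deriv L Pg x - real_RN_deriv L Q x)"

lemma subalgs: "subalgebra L G'" "subalgebra L G" "subalgebra Pg G" "subalgebra Q G'" "subalgebra Q G"
  using sub sets_eq_imp_space_eq[OF sets_eq] sets_eq by (auto simp: subalgebra_def L_def)

lemma finite_L: "finite_measure L"
  unfolding L_def using prob sets_eq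
  by (intro finite_measure_add_measure) (auto intro: prob_space.finite_measure)

text \<open>The same measure \<open>L\<close> is conditioned on both sigma-algebras; the prefixes
  \<open>fine\<close> and \<open>coarse\<close> keep the two sets of facts apart.\<close>

sublocale fine: finite_measure_subalgebra L G'
  using finite_L subalgs by (simp add: finite_measure_subalgebra_def finite_measure_subalgebra_axioms_def)

sublocale coarse: finite_measure_subalgebra L G
  using finite_L subalgs by (simp add: finite_measure_subalgebra_def finite_measure_subalgebra_axioms_def)

lemma f_density:
  shows integrable_f: "integrable L f"
    and measure_diff: "A \<in> sets L \<Longrightarrow> measure Pg A - measure Q A = (\<integral>x. indicator A x * f x \<partial>L)"
proof -
  have L: "sets Pg = sets L" "sets Q = sets L"
    using sets_eq by (simp_all add: L_def)
  note ac = absolutely_continuous_add_measure[OF sets_eq, folded L_def]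
  note fin = prob[THEN prob_space.finite_measure]
  note p = fine.real_RN_deriv_measure[OF fin(1) ac(1) L(1)]
  note q = fine.real_RN_deriv_measure[OF fin(2) ac(2) L(2)]
  show "integrable L f"
    using p(1) q(1) by (simp add: f_def)
  show "measure Pg A - measure Q A = (\<integral>x. indicator A x * f x \<partial>L)" if A: "A \<in> sets L"
    using integrable_mult_indicator[OF A p(1)] integrable_mult_indicator[OF A q(1)]
    by (simp add: p(2)[OF A] q(2)[OF A] f_def right_diff_distrib)
qed

text \<open>Both laws have total mass 1, so the masses cancel. This is the centring that the L1
  formula for the total variation requires.\<close>

lemma integral_f: "(\<integral>x. f x \<partial>L) = 0"
proof -
  have "(\<integral>x. f x \<partial>L) = (\<integral>x. indicator (space L) x * f x \<partial>L)"
    by (intro Bochner_Integration.integral_cong) auto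
  also have "\<dots> = measure Pg (space L) - measure Q (space L)"
    by (simp add: measure_diff)
  also have "\<dots> = 0"
    using prob[THEN prob_space.prob_space] sets_eq_imp_space_eq[OF sets_eq] by (simp add: L_def)
  finally show ?thesis .
qed

lemma TV_fine: "TV_on G' Pg Q = (\<integral>x. \<bar>real_cond_exp L G' f x\<bar> \<partial>L) / 2"
  using integrable_f integral_f sub subalgs
  by (intro fine.TV_on_eq_integral_cond_exp measure_diff) (auto simp: subalgebra_def)

lemma tower: "AE x in L. real_cond_exp L G (real_cond_exp L G' f) x = real_cond_exp L G f x"
  using subalgs(1) sub(2) integrable_f by (rule coarse.real_cond_exp_nested_subalg)

text \<open>The tower property expresses the coarse distance through the fine conditional
  expectation. Both distances then concern one function and its projection to \<open>G\<close>, to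
  which the L1 contraction applies.\<close>

lemma TV_coarse: "TV_on G Pg Q = (\<integral>x. \<bar>real_cond_exp L G (real_cond_exp L G' f) x\<bar> \<partial>L) / 2"
proof -
  have "TV_on G Pg Q = (\<integral>x. \<bar>real_cond_exp L G f x\<bar> \<partial>L) / 2"
    using integrable_f integral_f sub subalgs
    by (intro coarse.TV_on_eq_integral_cond_exp measure_diff) (auto simp: subalgebra_def)
  also have "(\<integral>x. \<bar>real_cond_exp L G f x\<bar> \<partial>L)
      = (\<integral>x. \<bar>real_cond_exp L G (real_cond_exp L G' f) x\<bar> \<partial>L)"
    by (rule integral_cong_AE) (use tower in auto)
  finally show ?thesis .
qed

lemma TV_nonneg: "0 \<le> TV_on G Pg Q"
  by (simp add: TV_coarse)

lemma TV_mono: "TV_on G Pg Q \<le> TV_on G' Pg Q"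
  using coarse.integral_abs_real_cond_exp_le[OF fine.real_cond_exp_int(1)[OF integrable_f]]
  by (simp add: TV_coarse TV_fine)

lemma TV_eq_iff:
  "TV_on G Pg Q = TV_on G' Pg Q \<longleftrightarrow>
    (AE x in L. \<bar>real_cond_exp L G f x\<bar> = real_cond_exp L G (\<lambda>y. \<bar>real_cond_exp L G' f y\<bar>) x)"
  (is "_ \<longleftrightarrow> (AE x in L. _ = ?R x)")
proof -
  have "TV_on G Pg Q = TV_on G' Pg Q \<longleftrightarrow>
      (AE x in L. \<bar>real_cond_exp L G (real_cond_exp L G' f) x\<bar> = ?R x)"
    using coarse.integral_abs_real_cond_exp_eq_iff[OF fine.real_cond_exp_int(1)[OF integrable_f]]
    by (simp add: TV_coarse TV_fine)
  also have "\<dots> \<longleftrightarrow> (AE x in L. \<bar>real_cond_exp L G f x\<bar> = ?R x)"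
    \<comment> \<open>The tower property is used backwards here, to return from the iterated
      conditional expectation to the direct one.\<close>
    by (rule eventually_subst) (use tower in eventually_elim, simp)
  finally show ?thesis .
qed

lemma TV_eq_iff_constant_sign:
  "TV_on G Pg Q = TV_on G' Pg Q \<longleftrightarrow> cond_constant_sign L G (real_cond_exp L G' f)"
  using coarse.integral_abs_real_cond_exp_eq_iff[OF fine.real_cond_exp_int(1)[OF integrable_f]]
    coarse.abs_real_cond_exp_eq_iff_cond_constant_sign[OF fine.real_cond_exp_int(1)[OF integrable_f]]
  by (simp add: TV_coarse TV_fine)

lemma TV_less_iff:
  "TV_on G Pg Q < TV_on G' Pg Q \<longleftrightarrow>
    emeasure L {x \<in> space L. both_signs L G (real_cond_exp L G' f) x} > 0"
  using TV_mono TV_eq_iff_constant_sign not_cond_constant_sign_iff[of L G "real_cond_exp L G' f"]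
  by linarith

end

section \<open>Decision rules and the combined result\<close>

lemma rules_mono:
  assumes "subalgebra G' G"
  shows "rules G \<subseteq> rules G'"
  using assms measurable_from_subalg[OF assms] by (auto simp: rules_def subalgebra_def)

text \<open>That coarse rules cannot outperform fine ones is expressed twice: by a single fine rule
  that does at least as well against all adversaries at once, and by optimal values for every
  \<open>loss\<close> on the error rates. Values in \<open>ereal\<close> make all these infima
  exist.\<close>

theorem theorem3:
  fixes H :: "'h measure" and Pg :: "'h measure"
    and P :: "'a \<Rightarrow> 'h measure" and \<A> :: "'a set"
    and G G' :: "'h measure"
  assumes Pg: "prob_space Pg" "sets Pg = sets H"
    and nonempty: "\<A> \<noteq> {}"
    and P: "\<And>\<alpha>. \<alpha> \<in> \<A> \<Longrightarrow> prob_space (P \<alpha>)" "\<And>\<alpha>. \<alpha> \<in> \<A> \<Longrightarrow> sets (P \<alpha>) = sets H"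
    and sub: "subalgebra H G'" "subalgebra G' G"
  shows "(\<forall>\<alpha>\<in>\<A>. TV_on G Pg (P \<alpha>) \<le> TV_on G' Pg (P \<alpha>)) \<and>
    TV_inf G Pg P \<A> \<le> TV_inf G' Pg P \<A> \<and>
    (\<forall>\<alpha>\<in>\<A>.
      let L = add_measure Pg (P \<alpha>);
          p = real_RN_deriv L Pg;
          q = real_RN_deriv L (P \<alpha>);
          D = real_cond_exp L G (\<lambda>x. p x - q x);
          D' = real_cond_exp L G' (\<lambda>x. p x - q x)
      in (TV_on G Pg (P \<alpha>) = TV_on G' Pg (P \<alpha>) \<longleftrightarrow>
            (AE x in L. \<bar>D x\<bar> = real_cond_exp L G (\<lambda>y. \<bar>D' y\<bar>) x)) \<and>
         (TV_on G Pg (P \<alpha>) = TV_on G' Pg (P \<alpha>) \<longleftrightarrow> cond_constant_sign L G D') \<and>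
         (TV_on G Pg (P \<alpha>) < TV_on G' Pg (P \<alpha>) \<longleftrightarrow>
            emeasure L {x \<in> space L. both_signs L G D' x} > 0)) \<and>
    rules G \<subseteq> rules G' \<and>
    (\<forall>\<alpha>\<in>\<A>. achievable G Pg (P \<alpha>) \<subseteq> achievable G' Pg (P \<alpha>)) \<and>
    (\<forall>d\<in>rules G. \<exists>d'\<in>rules G'.
        (\<forall>\<alpha>\<in>\<A>. FUR (P \<alpha>) d' \<le> FUR (P \<alpha>) d) \<and> RRL Pg d' \<le> RRL Pg d) \<and>
    (\<forall>loss :: ('a \<Rightarrow> real) \<Rightarrow> real \<Rightarrow> ereal.
        (INF d'\<in>rules G'. loss (\<lambda>\<alpha>. FUR (P \<alpha>) d') (RRL Pg d'))
          \<le> (INF d\<in>rules G. loss (\<lambda>\<alpha>. FUR (P \<alpha>) d) (RRL Pg d)))"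
proof -
  have pair: "dominated_pair Pg (P \<alpha>) G G'" if "\<alpha> \<in> \<A>" for \<alpha>
    using Pg P[OF that] sub sets_eq_imp_space_eq[OF Pg(2)]
    by (simp add: dominated_pair_def subalgebra_def)
  have TV_mono: "TV_on G Pg (P \<alpha>) \<le> TV_on G' Pg (P \<alpha>)" if "\<alpha> \<in> \<A>" for \<alpha>
    using dominated_pair.TV_mono[OF pair[OF that]] .
  \<comment> \<open>Real infima are monotone only for families bounded below; nonnegativity of the
    total variation supplies the bound 0.\<close>
  have "bdd_below ((\<lambda>\<alpha>. TV_on G Pg (P \<alpha>)) ` \<A>)"
    by (rule bdd_belowI[of _ 0]) (use dominated_pair.TV_nonneg[OF pair] in auto)
  then have "TV_inf G Pg P \<A> \<le> TV_inf G' Pg P \<A>"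
    unfolding TV_inf_def using nonempty TV_mono by (intro cINF_mono) auto
  moreover have "rules G \<subseteq> rules G'"
    by (rule rules_mono[OF sub(2)])
  moreover have "let L = add_measure Pg (P \<alpha>);
          p = real_RN_deriv L Pg;
          q = real_RN_deriv L (P \<alpha>);
          D = real_cond_exp L G (\<lambda>x. p x - q x);
          D' = real_cond_exp L G' (\<lambda>x. p x - q x)
      in (TV_on G Pg (P \<alpha>) = TV_on G' Pg (P \<alpha>) \<longleftrightarrow>
            (AE x in L. \<bar>D x\<bar> = real_cond_exp L G (\<lambda>y. \<bar>D' y\<bar>) x)) \<and>
         (TV_on G Pg (P \<alpha>) = TV_on G' Pg (P \<alpha>) \<longleftrightarrow> cond_constant_sign L G D') \<and>
         (TV_on G Pg (P \<alpha>) < TV_on G' Pg (P \<alpha>) \<longleftrightarrow>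
            emeasure L {x \<in> space L. both_signs L G D' x} > 0)" if \<alpha>: "\<alpha> \<in> \<A>" for \<alpha>
  proof -
    interpret dominated_pair Pg "P \<alpha>" G G'
      by (rule pair[OF \<alpha>])
    show ?thesis
      unfolding Let_def using TV_eq_iff TV_eq_iff_constant_sign TV_less_iff
      unfolding L_def f_def by blast
  qed
  ultimately show ?thesis
    \<comment> \<open>All claims on rules follow from \<open>rules G \<subseteq> rules G'\<close>:
      images grow with the set, a coarse rule is its own witness \<open>d'\<close>, and an infimum
      over a larger set is no larger.\<close>
    using TV_mono
    by (intro conjI ballI allI) (auto simp: achievable_def intro: INF_superset_mono)
qed

end
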